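(* Let $X_1,X_2,\dots$ be independent positive random variables with continuous (non-atomic) distribution functions $F_i(x)=P(X_i\le x)$, where $F_i(0)=0$ and $F_i(x)>0$ for all $x>0$. Put $\nu_i(x)=-\ln F_i(x)$ for $x>0$ and $\nu_i(0)=\infty$. Assume that: (1) for all $i\ge 1$, $$\nu_i(x)=c_i\,r(x)\,(1+\delta_i(x)),$$ where the $c_i$ are non-negative constants; $r(x)$ is a non-negative, continuous, non-increasing function with $r(0)=\infty$ and $r(\infty)=0$; the functions $\delta_i$ are continuous; $\delta_i(x)\to 0$ as $x\to\infty$ uniformly in $i$; and there are positive constants $M<\infty$ and $m<1$ such that $-m\le\delta_i(x)\le M$ for all $i$ and $x$; (2) $b_n:=\sum_{i=1}^n c_i\to\infty$ as $n\to\infty$; (3) with $\alpha_{in}=c_i/b_n$, the probability measures $$\alpha_n:=\sum_{i=1}^n \alpha_{in}\,\delta_{\{i/n\}}$$ on $[0,1]$ converge weakly to a probability measure $\alpha$ on $[0,1]$ as $n\to\infty$. For $1\le i\le n$ set $p_{in}=P\{X_i=\max\{X_1,\dots,X_n\}\}$. Then the discrete measures $$\mu_n:=\sum_{i=1}^n p_{in}\,\delta_{\{i/n\}}$$ converge weakly to $\alpha$ as $n\to\infty$.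
   Context: Here $\delta_{\{x\}}$ denotes the unit point mass at the point $x$ (not to be confused with the functions $\delta_i(x)$). Also, $r(\infty)=0$ means $r(x)\to0$ as $x\to\infty$, and $r(0)=\infty$ together with continuity means $r(x)\to\infty$ as $x\to0^+$. The measure $\mu_n$ is the distribution of $A_n/n$, where $A_n=\arg\max\{X_1,\dots,X_n\}$ is the (almost surely unique) index at which the maximum is attained.
   Formalization: The function r is assumed strictly positive on (0,∞) rather than merely non-negative; if r may vanish from a finite point on, the condition δ_i(x)→0 as x→∞ does not control the δ_i where the maximum concentrates, and the claim fails. *)

theory Defs
  imports "HOL-Probability.Probability"
begin

definition grid_measure :: "nat \<Rightarrow> (nat \<Rightarrow> real) \<Rightarrow> real measure" where
  "grid_measure n w =
     distr (point_measure {1..n} (\<lambda>i. ennreal (w i))) borel (\<lambda>i. real i / real n)"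

text \<open>
  The measure above is the weighted sum of the unit point masses at the points \<open>i / n\<close>;
  \<open>return borel x\<close> is the unit point mass at \<open>x\<close>.
\<close>

lemma emeasure_grid_measure:
  assumes "A \<in> sets borel"
  shows "emeasure (grid_measure n w) A =
    (\<Sum>i=1..n. ennreal (w i) * emeasure (return borel (real i / real n)) A)"
proof -
  let ?g = "\<lambda>i::nat. real i / real n"
  have meas: "?g \<in> measurable (point_measure {1..n} (\<lambda>i. ennreal (w i))) borel"
    by (auto simp: measurable_def space_point_measure sets_point_measure)
  have "emeasure (grid_measure n w) A =
      emeasure (point_measure {1..n} (\<lambda>i. ennreal (w i))) (?g -` A \<inter> {1..n})"
    unfolding grid_measure_def using meas assms
    by (subst emeasure_distr) (auto simp: space_point_measure)
  also have "\<dots> = (\<Sum>i\<in>?g -` A \<inter> {1..n}. ennreal (w i))"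
    by (rule emeasure_point_measure_finite) auto
  also have "\<dots> = (\<Sum>i=1..n. if ?g i \<in> A then ennreal (w i) else 0)"
    by (rule sum.mono_neutral_cong_left) auto
  also have "\<dots> = (\<Sum>i=1..n. ennreal (w i) * emeasure (return borel (?g i)) A)"
    using assms by (intro sum.cong) (auto simp: indicator_def)
  finally show ?thesis .
qed

definition argmax_prob :: "'a measure \<Rightarrow> (nat \<Rightarrow> 'a \<Rightarrow> real) \<Rightarrow> nat \<Rightarrow> nat \<Rightarrow> real" where
  "argmax_prob M X n i = \<P>(\<omega> in M. X i \<omega> = Max ((\<lambda>j. X j \<omega>) ` {1..n}))"

text \<open>
  \<open>log_tail M Y x\<close> is \<open>- ln F x\<close>, where \<open>F\<close> is the distribution function of \<open>Y\<close>. It is meaningful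
  only where \<open>F x > 0\<close> (recall \<open>ln 0 = 0\<close>); the value \<open>\<infinity>\<close> at \<open>x = 0\<close> is not represented, so
  it may be used for \<open>x > 0\<close> only.
\<close>

definition log_tail :: "'a measure \<Rightarrow> ('a \<Rightarrow> real) \<Rightarrow> real \<Rightarrow> real" where
  "log_tail M Y x = - ln (cdf (distr M borel Y) x)"

end

theory Submission
  imports Defs
begin

text \<open>
  Since the probabilities \<open>p\<^sub>i\<^sub>n\<close> add up to at most one (ties are null events) and the weights
  \<open>\<alpha>\<^sub>i\<^sub>n\<close> add up to exactly one, it suffices to show that for every \<open>\<eta> > 0\<close> eventually
  \<open>(1 - \<eta>) \<alpha>\<^sub>i\<^sub>n \<le> p\<^sub>i\<^sub>n\<close> for all \<open>i\<close>: then the distribution functions differ by at most \<open>\<eta>\<close>.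

  For the lower bound, choose \<open>x > 0\<close> with \<open>\<bar>\<delta>\<^sub>i\<bar> < \<epsilon>\<close> on \<open>[x, \<infinity>)\<close>, and let \<open>Z\<close> be the maximum of
  \<open>x\<close> and of the \<open>X\<^sub>j\<close> with \<open>j \<noteq> i\<close>. Then \<open>p\<^sub>i\<^sub>n \<ge> P(Z < X\<^sub>i) = E (1 - F\<^sub>i(Z)) \<ge> P(T \<le> r(Z))\<close>, where
  \<open>T\<close> is independent of \<open>Z\<close> and exponential with rate \<open>a = (1 - \<epsilon>) c\<^sub>i\<close>. Likewise, for \<open>t \<le> r(x)\<close>,
  \<open>P(t \<le> r(Z)) \<ge> exp (- b t)\<close> with \<open>b = (1 + \<epsilon>) \<Sum>\<^sub>j\<^sub>\<noteq>\<^sub>i c\<^sub>j\<close>. So \<open>p\<^sub>i\<^sub>n\<close> is at least the probability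
  that an exponential clock of rate \<open>a\<close> rings before one of rate \<open>b\<close> and before time \<open>r(x)\<close>, namely
  \<open>a / (a + b) (1 - exp (- (a + b) r(x)))\<close>.
\<close>

section \<open>Independence and joint laws of pairs\<close>

text \<open>Both variables are measurable functions of restrictions of the family to the disjoint
  index sets \<open>{i}\<close> and \<open>J\<close>. Inserting \<open>x\<close> gives the maximum a
  meaning for empty \<open>J\<close> and keeps it at or above \<open>x\<close>.\<close>

lemma (in prob_space) indep_var_Max_insert:
  fixes X :: "'i \<Rightarrow> 'a \<Rightarrow> real"
  assumes J: "finite J" "i \<notin> J" and indep: "indep_vars (\<lambda>_. borel) X (insert i J)"
  shows "indep_var borel (X i) borel (\<lambda>\<omega>. Max (insert x ((\<lambda>j. X j \<omega>) ` J)))"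
proof -
  have max_eq: "Max (insert x (g ` J)) = (if J = {} then x else max x (Max (g ` J)))"
    for g :: "'i \<Rightarrow> real"
    using J by auto
  have meas: "(\<lambda>f. Max (insert x (f ` J))) \<in> borel_measurable (PiM J (\<lambda>_. borel))"
    unfolding max_eq using J by (auto intro!: borel_measurable_max borel_measurable_Max)
  have "indep_var
    borel ((\<lambda>f. f i) \<circ> (\<lambda>\<omega>. restrict (\<lambda>i. X i \<omega>) {i}))
    borel ((\<lambda>f. Max (insert x (f ` J))) \<circ> (\<lambda>\<omega>. restrict (\<lambda>i. X i \<omega>) J))"
    using J by (intro indep_var_compose[OF indep_var_restrict[OF indep] _ meas]) auto
  also have "((\<lambda>f. f i) \<circ> (\<lambda>\<omega>. restrict (\<lambda>i. X i \<omega>) {i})) = X i"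
    by auto
  also have "((\<lambda>f. Max (insert x (f ` J))) \<circ> (\<lambda>\<omega>. restrict (\<lambda>i. X i \<omega>) J))
      = (\<lambda>\<omega>. Max (insert x ((\<lambda>i. X i \<omega>) ` J)))"
    by (auto simp: fun_eq_iff cong: rev_conj_cong)
  finally show ?thesis
    unfolding indep_var_def .
qed

text \<open>Independence makes the joint law a product, which Tonelli's theorem slices along the
  second coordinate. It serves both for ties and for the event
  \<open>Z \<omega> < X i \<omega>\<close>.\<close>

lemma (in prob_space) emeasure_indep_var_pair:
  fixes X Z :: "'a \<Rightarrow> real"
  assumes "indep_var borel X borel Z" and S: "S \<in> sets (borel \<Otimes>\<^sub>M borel)"
  shows "emeasure M {\<omega> \<in> space M. (X \<omega>, Z \<omega>) \<in> S} =
    (\<integral>\<^sup>+z. emeasure (distr M borel X) {x. (x, z) \<in> S} \<partial>distr M borel Z)"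
proof -
  have [measurable]: "random_variable borel X" "random_variable borel Z"
    and eq: "distr M borel X \<Otimes>\<^sub>M distr M borel Z = distr M (borel \<Otimes>\<^sub>M borel) (\<lambda>\<omega>. (X \<omega>, Z \<omega>))"
    using assms(1) by (auto simp: indep_var_distribution_eq)
  interpret X: prob_space "distr M borel X" by (rule prob_space_distr) simp
  interpret Z: prob_space "distr M borel Z" by (rule prob_space_distr) simp
  interpret XZ: pair_sigma_finite "distr M borel X" "distr M borel Z" ..
  have "emeasure M {\<omega> \<in> space M. (X \<omega>, Z \<omega>) \<in> S}
      = emeasure (distr M (borel \<Otimes>\<^sub>M borel) (\<lambda>\<omega>. (X \<omega>, Z \<omega>))) S"
    using S by (subst emeasure_distr) (auto intro!: arg_cong[where f = "emeasure M"])
  also have "\<dots> = (\<integral>\<^sup>+z. emeasure (distr M borel X) ((\<lambda>x. (x, z)) -` S) \<partial>distr M borel Z)"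
    unfolding eq[symmetric] using S
    by (intro XZ.emeasure_pair_measure_alt2) (simp cong: sets_pair_measure_cong)
  finally show ?thesis
    by (simp add: vimage_def)
qed

text \<open>Given the value of \<open>Z\<close>, the slice is a single point, and a continuous
  distribution function gives points no mass.\<close>

lemma (in prob_space) prob_indep_var_eq_0:
  fixes X Z :: "'a \<Rightarrow> real"
  assumes indep: "indep_var borel X borel Z" and cont: "continuous_on UNIV (cdf (distr M borel X))"
  shows "prob {\<omega> \<in> space M. X \<omega> = Z \<omega>} = 0"
proof -
  have [measurable]: "random_variable borel X"
    using indep by (auto simp: indep_var_distribution_eq)
  interpret X: real_distribution "distr M borel X"
    by (rule real_distribution_distr) simp
  have "emeasure (distr M borel X) {z} = 0" for z
    using cont X.isCont_cdf[of z]
    by (simp add: continuous_on_eq_continuous_at X.emeasure_eq_measure)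
  moreover have "{p :: real \<times> real. fst p = snd p} \<in> sets (borel \<Otimes>\<^sub>M borel)"
    unfolding borel_prod by (intro borel_closed closed_Collect_eq continuous_intros)
  ultimately have "emeasure M {\<omega> \<in> space M. X \<omega> = Z \<omega>} = 0"
    using emeasure_indep_var_pair[OF indep, of "{p. fst p = snd p}"] by simp
  then show ?thesis
    by (simp add: measure_def)
qed

section \<open>The race against an exponential clock\<close>

text \<open>The integral is the probability of \<open>T \<le> h Z\<close>, with \<open>Z\<close> of
  law \<open>N\<close> and \<open>T\<close> independent of it, exponential of rate \<open>a\<close>.
  Integrating over \<open>T\<close> last and keeping only times in \<open>[0, s]\<close> leaves the
  integral of \<open>a * exp (- a * t) * exp (- b * t)\<close>.\<close>

lemma exponential_race_lower_bound:
  fixes N :: "real measure" and h :: "real \<Rightarrow> real"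
  assumes "prob_space N" and sets_N [measurable_cong]: "sets N = sets borel"
    and h [measurable]: "h \<in> borel_measurable borel"
    and a: "0 < a" and b: "0 \<le> b" and s: "0 \<le> s"
    and tail: "\<And>t. 0 \<le> t \<Longrightarrow> t \<le> s \<Longrightarrow> exp (- b * t) \<le> measure N {z. t \<le> h z}"
  shows "ennreal (a / (a + b) * (1 - exp (- (a + b) * s)))
    \<le> (\<integral>\<^sup>+z. emeasure (density lborel (exponential_density a)) {..h z} \<partial>N)"
proof -
  let ?E = "\<lambda>l. density lborel (exponential_density l)"
  interpret N: prob_space N by fact
  interpret E: prob_space "?E a" using a by (rule prob_space_exponential_density)
  interpret P: pair_sigma_finite N "?E a" ..
  have ab: "0 < a + b" using a b by simp
  \<comment> \<open>The bound is read as a multiple of the exponential distribution function of rate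
    \<open>a + b\<close> at \<open>s\<close>, so that the integrands can be compared
    pointwise.\<close>
  have "ennreal (a / (a + b) * (1 - exp (- (a + b) * s))) = ennreal (a / (a + b)) * emeasure (?E (a + b)) {..s}"
    using ab a b s by (simp add: emeasure_erlang_density erlang_CDF_0 ennreal_mult'[symmetric])
  also have "\<dots> = (\<integral>\<^sup>+t. ennreal (a / (a + b)) * (ennreal (exponential_density (a + b) t) * indicator {..s} t) \<partial>lborel)"
    by (subst emeasure_density) (auto intro!: nn_integral_cmult[symmetric])
  also have "\<dots> \<le> (\<integral>\<^sup>+t. ennreal (exponential_density a t) * emeasure N {z. t \<le> h z} \<partial>lborel)"
  proof (intro nn_integral_mono)
    fix t :: real
    show "ennreal (a / (a + b)) * (ennreal (exponential_density (a + b) t) * indicator {..s} t)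
        \<le> ennreal (exponential_density a t) * emeasure N {z. t \<le> h z}"
    proof (cases "0 \<le> t \<and> t \<le> s")
      case True
      have "exp (- t * (a + b)) = exp (- t * a) * exp (- b * t)"
        by (simp add: exp_add[symmetric] algebra_simps)
      then have "a / (a + b) * exponential_density (a + b) t = exponential_density a t * exp (- b * t)"
        using True ab by (simp add: exponential_density_def)
      moreover have "0 \<le> exponential_density a t"
        using a by simp
      ultimately show ?thesis
        using True tail[of t] a b
        by (auto simp: N.emeasure_eq_measure ennreal_mult'[symmetric] intro!: ennreal_leI mult_left_mono)
    next
      \<comment> \<open>The left integrand vanishes: the density for \<open>t < 0\<close>, the
        indicator for \<open>t > s\<close>.\<close>
      case False
      then show ?thesis
        by (auto simp: exponential_density_def split: split_indicator)
    qed
  qed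
  also have "\<dots> = (\<integral>\<^sup>+t. emeasure N {z. t \<le> h z} \<partial>?E a)"
  proof -
    have "{p \<in> space (borel \<Otimes>\<^sub>M N). fst p \<le> h (snd p)} \<in> sets (borel \<Otimes>\<^sub>M N)"
      by measurable
    from N.measurable_emeasure_Pair[OF this]
    have "(\<lambda>t. emeasure N {z. t \<le> h z}) \<in> borel_measurable borel"
      by (simp add: space_pair_measure sets_eq_imp_space_eq[OF sets_N] vimage_def)
    then show ?thesis
      by (simp add: nn_integral_density)
  qed
  also have "\<dots> = (\<integral>\<^sup>+t. (\<integral>\<^sup>+z. indicator {(z, t). t \<le> h z} (z, t) \<partial>N) \<partial>?E a)"
  proof (intro nn_integral_cong)
    fix t :: real
    have "(\<integral>\<^sup>+z. indicator {(z, t). t \<le> h z} (z, t) \<partial>N) = (\<integral>\<^sup>+z. indicator {z. t \<le> h z} z \<partial>N)"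
      by (intro nn_integral_cong) (simp add: indicator_def)
    then show "emeasure N {z. t \<le> h z} = (\<integral>\<^sup>+z. indicator {(z, t). t \<le> h z} (z, t) \<partial>N)"
      by simp
  qed
  also have "\<dots> = (\<integral>\<^sup>+z. (\<integral>\<^sup>+t. indicator {(z, t). t \<le> h z} (z, t) \<partial>?E a) \<partial>N)"
    by (rule P.Fubini') (simp add: indicator_def)
  also have "\<dots> = (\<integral>\<^sup>+z. emeasure (?E a) {..h z} \<partial>N)"
  proof (intro nn_integral_cong)
    fix z :: real
    have "(\<integral>\<^sup>+t. indicator {(z, t). t \<le> h z} (z, t) \<partial>?E a) = (\<integral>\<^sup>+t. indicator {..h z} t \<partial>?E a)"
      by (intro nn_integral_cong) (simp add: indicator_def)
    then show "(\<integral>\<^sup>+t. indicator {(z, t). t \<le> h z} (z, t) \<partial>?E a) = emeasure (?E a) {..h z}"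
      by simp
  qed
  finally show ?thesis .
qed

text \<open>Since \<open>x \<le> y\<close>, the inserted constant imposes no constraint, and the
  remaining events \<open>X j \<omega> \<le> y\<close> are independent.\<close>

lemma (in prob_space) prob_Max_insert_le:
  fixes X :: "'i \<Rightarrow> 'a \<Rightarrow> real"
  assumes J: "finite J" and indep: "indep_vars (\<lambda>_. borel) X J" and "x \<le> y"
  shows "prob {\<omega> \<in> space M. Max (insert x ((\<lambda>j. X j \<omega>) ` J)) \<le> y}
    = (\<Prod>j\<in>J. cdf (distr M borel (X j)) y)"
proof (cases "J = {}")
  case True
  then show ?thesis using \<open>x \<le> y\<close> by (simp add: prob_space)
next
  case False
  have rv: "random_variable borel (X j)" if "j \<in> J" for j
    using indep that by (auto simp: indep_vars_def)
  have "{\<omega> \<in> space M. Max (insert x ((\<lambda>j. X j \<omega>) ` J)) \<le> y} = (\<Inter>j\<in>J. X j -` {..y} \<inter> space M)"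
    using J False \<open>x \<le> y\<close> by auto
  then have "prob {\<omega> \<in> space M. Max (insert x ((\<lambda>j. X j \<omega>) ` J)) \<le> y}
      = (\<Prod>j\<in>J. prob (X j -` {..y} \<inter> space M))"
    using indep_varsD[OF indep False J order_refl, of "\<lambda>_. {..y}"] by simp
  then show ?thesis
    using rv by (simp add: cdf_def measure_distr)
qed

text \<open>This is the race with \<open>h z = r (max x z)\<close> and rates \<open>a\<close> and
  \<open>sum b J\<close>. Truncation at \<open>x\<close> confines every use of \<open>upper\<close>
  and \<open>lower\<close> to the half-line where they hold.\<close>

lemma (in prob_space) prob_argmax_lower_bound:
  fixes X :: "'i \<Rightarrow> 'a \<Rightarrow> real" and b :: "'i \<Rightarrow> real"
  assumes J: "finite J" "i \<notin> J" and indep: "indep_vars (\<lambda>_. borel) X (insert i J)"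
    and r_cont: "continuous_on {x..} r" and r_mono: "antimono_on {x..} r"
    and r_nonneg: "\<And>y. x \<le> y \<Longrightarrow> 0 \<le> r y" and r_lim: "(r \<longlongrightarrow> 0) at_top"
    and a: "0 < a" and b: "\<And>j. j \<in> J \<Longrightarrow> 0 \<le> b j"
    and upper: "\<And>y. x \<le> y \<Longrightarrow> cdf (distr M borel (X i)) y \<le> exp (- a * r y)"
    and lower: "\<And>y j. j \<in> J \<Longrightarrow> x \<le> y \<Longrightarrow> exp (- b j * r y) \<le> cdf (distr M borel (X j)) y"
  shows "a / (a + sum b J) * (1 - exp (- (a + sum b J) * r x))
    \<le> prob {\<omega> \<in> space M. \<forall>j\<in>J. X j \<omega> \<le> X i \<omega>}"
proof -
  define Z where "Z = (\<lambda>\<omega>. Max (insert x ((\<lambda>j. X j \<omega>) ` J)))"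
  define D where "D = distr M borel (X i)"
  define N where "N = distr M borel Z"
  \<comment> \<open>Extending \<open>r\<close> by a constant to the left of \<open>x\<close> makes
    it continuous on the whole line, and \<open>h\<close> agrees with \<open>r\<close> at the values
    of \<open>Z\<close>.\<close>
  define h where "h = (\<lambda>z. r (max x z))"
  have indep_Z: "indep_var borel (X i) borel Z"
    unfolding Z_def using J indep by (rule indep_var_Max_insert)
  then have [measurable]: "random_variable borel (X i)" "random_variable borel Z"
    by (auto simp: indep_var_distribution_eq)
  have rv [measurable]: "random_variable borel (X j)" if "j \<in> J" for j
    using indep that by (auto simp: indep_vars_def)
  interpret D: real_distribution D
    unfolding D_def by (rule real_distribution_distr) simp
  interpret N: real_distribution N
    unfolding N_def by (rule real_distribution_distr) simp
  have "continuous_on UNIV h"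
    unfolding h_def by (intro continuous_on_compose2[OF r_cont]) (auto intro!: continuous_intros)
  then have h: "h \<in> borel_measurable borel"
    by (rule borel_measurable_continuous_onI)
  have b_sum: "0 \<le> sum b J"
    using b by (rule sum_nonneg)
  have tail: "exp (- sum b J * t) \<le> measure N {z. t \<le> h z}" if t: "0 \<le> t" "t \<le> r x" for t
  proof (cases "t = 0")
    \<comment> \<open>The value 0 is treated apart because \<open>r\<close> may approach it without
      attaining it; every \<open>t\<close> in \<open>(0, r x]\<close> is attained by the
      intermediate value theorem.\<close>
    case True
    have "{z. 0 \<le> h z} = UNIV"
      using r_nonneg by (auto simp: h_def)
    then show ?thesis
      using True N.prob_space by simp
  next
    case False
    then have "eventually (\<lambda>y. r y < t) at_top"
      using t r_lim by (intro order_tendstoD) auto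
    then have "eventually (\<lambda>y. x \<le> y \<and> r y < t) at_top"
      using eventually_ge_at_top[of x] by eventually_elim auto
    then obtain w where w: "x \<le> w" "r w < t"
      unfolding eventually_at_top_linorder by blast
    have "\<exists>y\<ge>x. y \<le> w \<and> r y = t"
      using w t by (intro IVT2') (auto intro: continuous_on_subset[OF r_cont])
    then obtain y where y: "x \<le> y" "r y = t"
      by auto
    have "exp (- sum b J * t) = (\<Prod>j\<in>J. exp (- b j * r y))"
      using J y by (simp add: exp_sum[symmetric] sum_distrib_right sum_negf)
    also have "\<dots> \<le> (\<Prod>j\<in>J. cdf (distr M borel (X j)) y)"
      using lower y by (intro prod_mono) auto
    also have "\<dots> = prob {\<omega> \<in> space M. Z \<omega> \<le> y}"
      unfolding Z_def using J y indep
      by (intro prob_Max_insert_le[symmetric]) (auto intro: indep_vars_subset)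
    also have "\<dots> = measure N {..y}"
      unfolding N_def by (subst measure_distr) (auto intro!: arg_cong[where f = prob])
    also have "\<dots> \<le> measure N {z. t \<le> h z}"
    proof (rule N.finite_measure_mono)
      show "{..y} \<subseteq> {z. t \<le> h z}"
        using y r_mono by (auto simp: h_def monotone_on_def)
      show "{z. t \<le> h z} \<in> sets N"
        using h by (simp add: N_def)
    qed
    finally show ?thesis .
  qed
  have "ennreal (a / (a + sum b J) * (1 - exp (- (a + sum b J) * r x)))
      \<le> (\<integral>\<^sup>+z. emeasure (density lborel (exponential_density a)) {..h z} \<partial>N)"
    using N.prob_space_axioms h a b_sum r_nonneg[of x] tail
    by (intro exponential_race_lower_bound) auto
  \<comment> \<open>By \<open>upper\<close>, the chance \<open>1 - exp (- a * h z)\<close> that the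
    clock rings by \<open>h z\<close> is at most the chance that \<open>X i\<close> exceeds
    \<open>max x z\<close>.\<close>
  also have "\<dots> \<le> (\<integral>\<^sup>+z. emeasure D {y. z < y} \<partial>N)"
  proof (rule nn_integral_mono)
    fix z
    have "emeasure (density lborel (exponential_density a)) {..h z} = ennreal (1 - exp (- a * h z))"
      using a r_nonneg by (simp add: emeasure_erlang_density erlang_CDF_0 h_def)
    also have "\<dots> \<le> ennreal (1 - cdf D (max x z))"
      using upper[of "max x z"] by (intro ennreal_leI) (auto simp: D_def h_def)
    also have "1 - cdf D (max x z) = measure D (UNIV - {..max x z})"
      using D.prob_compl[of "{..max x z}"] by (simp add: cdf_def)
    also have "ennreal \<dots> \<le> emeasure D {y. z < y}"
      unfolding D.emeasure_eq_measure by (intro ennreal_leI D.finite_measure_mono) auto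
    finally show "emeasure (density lborel (exponential_density a)) {..h z} \<le> emeasure D {y. z < y}" .
  qed
  also have "\<dots> = emeasure M {\<omega> \<in> space M. Z \<omega> < X i \<omega>}"
  proof -
    have "{p :: real \<times> real. snd p < fst p} \<in> sets (borel \<Otimes>\<^sub>M borel)"
      unfolding borel_prod by (intro borel_open open_Collect_less continuous_intros)
    from emeasure_indep_var_pair[OF indep_Z this] show ?thesis
      by (simp add: D_def N_def)
  qed
  also have "\<dots> \<le> emeasure M {\<omega> \<in> space M. \<forall>j\<in>J. X j \<omega> \<le> X i \<omega>}"
  proof (rule emeasure_mono)
    show "{\<omega> \<in> space M. Z \<omega> < X i \<omega>} \<subseteq> {\<omega> \<in> space M. \<forall>j\<in>J. X j \<omega> \<le> X i \<omega>}"
      using J by (auto simp: Z_def intro: less_imp_le)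
    show "{\<omega> \<in> space M. \<forall>j\<in>J. X j \<omega> \<le> X i \<omega>} \<in> sets M"
      using J by measurable
  qed
  finally show ?thesis
    by (simp add: emeasure_eq_measure)
qed

section \<open>Comparison of weights and ties of the maximum\<close>

lemma cdf_grid_measure:
  assumes "\<And>i. i \<in> {1..n} \<Longrightarrow> 0 \<le> w i"
  shows "cdf (grid_measure n w) x = (\<Sum>i | i \<in> {1..n} \<and> real i / real n \<le> x. w i)"
proof -
  have "emeasure (grid_measure n w) {..x} = (\<Sum>i=1..n. ennreal (w i) * indicator {..x} (real i / real n))"
    by (subst emeasure_grid_measure) simp_all
  also have "\<dots> = (\<Sum>i=1..n. ennreal (if real i / real n \<le> x then w i else 0))"
    by (intro sum.cong) (auto simp: indicator_def)
  also have "\<dots> = ennreal (\<Sum>i=1..n. if real i / real n \<le> x then w i else 0)"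
    using assms by (intro sum_ennreal) auto
  also have "(\<Sum>i=1..n. if real i / real n \<le> x then w i else 0)
      = (\<Sum>i | i \<in> {1..n} \<and> real i / real n \<le> x. w i)"
    by (rule sum.inter_filter[symmetric]) simp
  finally have "emeasure (grid_measure n w) {..x}
      = ennreal (\<Sum>i | i \<in> {1..n} \<and> real i / real n \<le> x. w i)" .
  moreover have "0 \<le> (\<Sum>i | i \<in> {1..n} \<and> real i / real n \<le> x. w i)"
    using assms by (intro sum_nonneg) auto
  ultimately show ?thesis
    by (simp add: cdf_def measure_def)
qed

text \<open>The one-sided bound loses at most \<open>\<eta>\<close> on any subset. Applied to
  \<open>I - S\<close>, it becomes an upper bound on \<open>S\<close>, because \<open>p\<close> has
  total at most 1 and \<open>q\<close> exactly 1.\<close>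

lemma abs_diff_sum_subset_le:
  fixes p q :: "'i \<Rightarrow> real"
  assumes I: "finite I" "S \<subseteq> I" and q: "\<And>i. i \<in> I \<Longrightarrow> 0 \<le> q i" "sum q I = 1" and p: "sum p I \<le> 1"
    and \<eta>: "0 \<le> \<eta>" and le: "\<And>i. i \<in> I \<Longrightarrow> (1 - \<eta>) * q i \<le> p i"
  shows "\<bar>sum p S - sum q S\<bar> \<le> \<eta>"
proof -
  have lower: "sum q T - \<eta> \<le> sum p T" if "T \<subseteq> I" for T
  proof -
    have "(1 - \<eta>) * sum q T \<le> sum p T"
      unfolding sum_distrib_left using that by (intro sum_mono le) auto
    moreover have "sum q T \<le> 1"
      unfolding q(2)[symmetric] using that I q by (intro sum_mono2) auto
    ultimately show ?thesis
      using mult_left_mono[OF \<open>sum q T \<le> 1\<close> \<eta>] by (simp add: algebra_simps)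
  qed
  have split: "sum f I = sum f S + sum f (I - S)" for f :: "'i \<Rightarrow> real"
    using sum.subset_diff[of S I f] I by simp
  show ?thesis
    using lower[of S] lower[of "I - S"] I split[of p] split[of q] p q by auto
qed

text \<open>Two of the events overlap only in a tie, which is null, so almost surely at most one
  indicator is 1; integrating gives the bound.\<close>

lemma (in prob_space) sum_argmax_prob_le_1:
  fixes X :: "nat \<Rightarrow> 'a \<Rightarrow> real"
  assumes indep: "indep_vars (\<lambda>_. borel) X {1..n}"
    and cont: "\<And>i. i \<in> {1..n} \<Longrightarrow> continuous_on UNIV (cdf (distr M borel (X i)))"
  shows "(\<Sum>i=1..n. argmax_prob M X n i) \<le> 1"
proof -
  define A where "A i = {\<omega> \<in> space M. X i \<omega> = Max ((\<lambda>j. X j \<omega>) ` {1..n})}" for i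
  have rv [measurable]: "random_variable borel (X i)" if "i \<in> {1..n}" for i
    using indep that by (auto simp: indep_vars_def)
  have A: "A i \<in> events" if "i \<in> {1..n}" for i
    unfolding A_def using that by measurable
  have "AE \<omega> in M. \<omega> \<notin> A i \<inter> A j" if "i \<in> {1..n}" "j \<in> {1..n}" "i \<noteq> j" for i j
  proof -
    have "indep_vars (\<lambda>_. borel) X (insert i {j})"
      using indep that by (intro indep_vars_subset[OF indep]) auto
    \<comment> \<open>The minimum over the singleton \<open>{j}\<close> is \<open>X j\<close>
      itself.\<close>
    from indep_vars_Min[OF _ _ this] that have "indep_var borel (X i) borel (X j)"
      by simp
    then have "prob {\<omega> \<in> space M. X i \<omega> = X j \<omega>} = 0"
      using cont that by (intro prob_indep_var_eq_0)
    moreover have "prob (A i \<inter> A j) \<le> prob {\<omega> \<in> space M. X i \<omega> = X j \<omega>}"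
      using that by (intro finite_measure_mono) (auto simp: A_def)
    ultimately have "prob (A i \<inter> A j) = 0"
      by (simp add: measure_le_0_iff)
    then show ?thesis
      using prob_eq_0[of "A i \<inter> A j"] A that by auto
  qed
  then have "AE \<omega> in M. \<forall>i\<in>{1..n}. \<forall>j\<in>{1..n}. i \<noteq> j \<longrightarrow> \<omega> \<notin> A i \<inter> A j"
    by (intro AE_finite_allI AE_impI) auto
  then have "AE \<omega> in M. (\<Sum>i=1..n. indicator (A i) \<omega>) \<le> (1::real)"
  proof eventually_elim
    case (elim \<omega>)
    have "(\<Sum>i=1..n. indicator (A i) \<omega>) = real (card ({1..n} \<inter> {i. \<omega> \<in> A i}))"
      by (simp add: indicator_def sum.If_cases)
    also have "\<dots> \<le> 1"
      using elim by (auto simp: card_le_Suc0_iff_eq)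
    finally show ?case .
  qed
  then have "(\<integral>\<omega>. (\<Sum>i=1..n. indicator (A i) \<omega>) \<partial>M) \<le> (\<integral>\<omega>. 1 \<partial>M :: real)"
    using A by (intro integral_mono_AE) (auto simp: less_top[symmetric])
  also have "(\<integral>\<omega>. (\<Sum>i=1..n. indicator (A i) \<omega>) \<partial>M) = (\<Sum>i=1..n. prob (A i))"
    using A by (subst Bochner_Integration.integral_sum)
      (auto simp: less_top[symmetric] sets.Int_space_eq2)
  finally show ?thesis
    by (simp add: argmax_prob_def A_def prob_space)
qed

section \<open>Weak convergence of the argmax distributions\<close>

theorem theorem2:
  fixes M :: "'a measure"
    and X :: "nat \<Rightarrow> 'a \<Rightarrow> real"
    and c :: "nat \<Rightarrow> real"
    and r :: "real \<Rightarrow> real"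
    and \<delta> :: "nat \<Rightarrow> real \<Rightarrow> real"
    and m K :: real
    and \<alpha> :: "real measure"
  assumes "prob_space M"
    and "prob_space.indep_vars M (\<lambda>_. borel) X {1..}"
    and "\<And>i. i \<ge> 1 \<Longrightarrow> AE \<omega> in M. X i \<omega> > 0"
    and "\<And>i. i \<ge> 1 \<Longrightarrow> continuous_on UNIV (cdf (distr M borel (X i)))"
    and "\<And>i. i \<ge> 1 \<Longrightarrow> cdf (distr M borel (X i)) 0 = 0"
    and "\<And>i x. i \<ge> 1 \<Longrightarrow> x > 0 \<Longrightarrow> cdf (distr M borel (X i)) x > 0"
    and "\<And>i x. i \<ge> 1 \<Longrightarrow> x > 0 \<Longrightarrow> log_tail M (X i) x = c i * r x * (1 + \<delta> i x)"
    and "\<And>i. i \<ge> 1 \<Longrightarrow> c i \<ge> 0"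
    and "\<And>x. x > 0 \<Longrightarrow> r x > 0"
    and "continuous_on {0<..} r"
    and "antimono_on {0<..} r"
    and "filterlim r at_top (at_right 0)"
    and "(r \<longlongrightarrow> 0) at_top"
    and "\<And>i. i \<ge> 1 \<Longrightarrow> continuous_on {0<..} (\<delta> i)"
    and "uniform_limit {1..} (\<lambda>x i. \<delta> i x) (\<lambda>_. 0) at_top"
    and "0 < m" and "m < 1" and "0 < K"
    and "\<And>i x. i \<ge> 1 \<Longrightarrow> x > 0 \<Longrightarrow> - m \<le> \<delta> i x \<and> \<delta> i x \<le> K"
    and "filterlim (\<lambda>n. \<Sum>i=1..n. c i) at_top sequentially"
    and "prob_space \<alpha>" and "sets \<alpha> = sets borel" and "measure \<alpha> {0..1} = 1"
    and "weak_conv_m (\<lambda>n. grid_measure n (\<lambda>i. c i / (\<Sum>j=1..n. c j))) \<alpha>"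
  shows "weak_conv_m (\<lambda>n. grid_measure n (argmax_prob M X n)) \<alpha>"
proof -
  interpret prob_space M by fact
  note indep = assms(2) and cdf_cont = assms(4) and cdf_pos = assms(6) and log_tail = assms(7)
    and c = assms(8) and r_pos = assms(9) and r_cont = assms(10) and r_mono = assms(11)
    and r_lim = assms(13) and \<delta>_lim = assms(15) and c_sum = assms(20) and conv = assms(24)
  define s where "s n = (\<Sum>i=1..n. c i)" for n
  define p where "p n = argmax_prob M X n" for n
  define q where "q n i = c i / s n" for n i
  have p_nonneg: "0 \<le> p n i" for n i
    by (simp add: p_def argmax_prob_def)
  \<comment> \<open>Positivity of the distribution function excludes the default
    \<open>ln 0 = 0\<close>, so the logarithm can be inverted.\<close>
  have cdf_eq: "cdf (distr M borel (X i)) y = exp (- (c i * r y * (1 + \<delta> i y)))" if "1 \<le> i" "0 < y" for i y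
  proof -
    have "ln (cdf (distr M borel (X i)) y) = - (c i * r y * (1 + \<delta> i y))"
      using log_tail[OF that] by (simp add: log_tail_def)
    then show ?thesis
      by (metis exp_ln cdf_pos[OF that])
  qed
  have main: "eventually (\<lambda>n. \<forall>i\<in>{1..n}. (1 - \<eta>) * q n i \<le> p n i) sequentially"
    if \<eta>: "0 < \<eta>" "\<eta> < 1" for \<eta>
  proof -
    \<comment> \<open>Two factors \<open>1 - \<eta> / 2\<close> may be lost, one to the perturbed
      rates and one to the truncation at \<open>x\<close>. The first needs
      \<open>(1 - \<eta> / 2) * (1 + \<epsilon>) \<le> 1 - \<epsilon>\<close>, which holds for a
      quarter of \<open>\<eta>\<close>.\<close>
    define \<epsilon> where "\<epsilon> = \<eta> / 4"
    have \<epsilon>: "0 < \<epsilon>" "\<epsilon> < 1"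
      using \<eta> by (auto simp: \<epsilon>_def)
    have "eventually (\<lambda>y. 0 < y \<and> (\<forall>i\<in>{1..}. dist (\<delta> i y) 0 < \<epsilon>)) at_top"
      using uniform_limitD[OF \<delta>_lim \<epsilon>(1)] eventually_gt_at_top[of 0] by eventually_elim auto
    then obtain x where "\<forall>y\<ge>x. 0 < y \<and> (\<forall>i\<in>{1..}. dist (\<delta> i y) 0 < \<epsilon>)"
      by (auto simp: eventually_at_top_linorder)
    then have x: "0 < x" and \<delta>_small: "\<And>i y. 1 \<le> i \<Longrightarrow> x \<le> y \<Longrightarrow> \<bar>\<delta> i y\<bar> < \<epsilon>"
      by auto
    \<comment> \<open>As \<open>r x > 0\<close> and \<open>s n\<close> diverges, the truncation term
      \<open>exp (- L * r x)\<close> will drop below \<open>\<eta> / 2\<close>. The threshold on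
      \<open>n\<close> involves only \<open>s n\<close>, so it is uniform in
      \<open>i\<close>.\<close>
    have "filterlim (\<lambda>n. ((1 - \<epsilon>) * r x) * s n) at_top sequentially"
      using c_sum \<epsilon> r_pos[OF x] unfolding s_def
      by (intro filterlim_tendsto_pos_mult_at_top[OF tendsto_const]) auto
    then have "eventually (\<lambda>n. - ln (\<eta> / 2) \<le> ((1 - \<epsilon>) * r x) * s n) sequentially"
      by (simp add: filterlim_at_top)
    moreover have "eventually (\<lambda>n. 0 < s n) sequentially"
      using c_sum by (simp add: filterlim_at_top_dense s_def)
    ultimately show ?thesis
    proof eventually_elim
      case (elim n)
      show ?case
      proof
        fix i assume i: "i \<in> {1..n}"
        show "(1 - \<eta>) * q n i \<le> p n i"
        \<comment> \<open>The race needs a positive rate; for a zero rate the claim reduces to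
          nonnegativity of \<open>p n i\<close>.\<close>
        proof (cases "c i = 0")
          case True
          then show ?thesis using p_nonneg by (simp add: q_def)
        next
          case False
          then have ci: "0 < c i"
            using c[of i] i by simp
          define J where "J = {1..n} - {i}"
          have J: "finite J" "i \<notin> J" "insert i J = {1..n}"
            using i by (auto simp: J_def)
          \<comment> \<open>The total rate of the race lies between
            \<open>(1 - \<epsilon>) * s n\<close> and \<open>(1 + \<epsilon>) * s n\<close>: the
            lower bound controls the truncation term, the upper bound the ratio of rates.\<close>
          define L where "L = (1 - \<epsilon>) * c i + (\<Sum>j\<in>J. (1 + \<epsilon>) * c j)"
          have s_eq: "s n = c i + sum c J"
            unfolding s_def J(3)[symmetric] using J(1,2) by simp
          have cJ: "0 \<le> sum c J"
            using c by (intro sum_nonneg) (auto simp: J_def)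
          have L_eq: "L = (1 - \<epsilon>) * c i + (1 + \<epsilon>) * sum c J"
            by (simp add: L_def sum_distrib_left)
          have L_ge: "(1 - \<epsilon>) * s n \<le> L"
            unfolding L_eq s_eq using cJ \<epsilon> by (simp add: algebra_simps)
          have L_le: "L \<le> (1 + \<epsilon>) * s n"
            unfolding L_eq s_eq using ci \<epsilon> by (simp add: algebra_simps)
          have L_pos: "0 < L"
            using L_ge elim(2) \<epsilon> by (smt (verit) mult_pos_pos)
          have bound: "(1 - \<epsilon>) * c i / L * (1 - exp (- L * r x)) \<le> p n i"
          proof -
            have "(1 - \<epsilon>) * c i / ((1 - \<epsilon>) * c i + (\<Sum>j\<in>J. (1 + \<epsilon>) * c j))
                * (1 - exp (- ((1 - \<epsilon>) * c i + (\<Sum>j\<in>J. (1 + \<epsilon>) * c j)) * r x))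
              \<le> prob {\<omega> \<in> space M. \<forall>j\<in>J. X j \<omega> \<le> X i \<omega>}"
            proof (rule prob_argmax_lower_bound[where r = r])
              show "indep_vars (\<lambda>_. borel) X (insert i J)"
                using J by (intro indep_vars_subset[OF indep]) auto
              show "continuous_on {x..} r"
                using x by (intro continuous_on_subset[OF r_cont]) auto
              show "antimono_on {x..} r"
                using x r_mono by (auto simp: monotone_on_def)
              show "0 \<le> r y" if "x \<le> y" for y
                using r_pos[of y] x that by simp
              show "cdf (distr M borel (X i)) y \<le> exp (- ((1 - \<epsilon>) * c i) * r y)" if "x \<le> y" for y
              proof -
                have "c i * r y * (1 - \<epsilon>) \<le> c i * r y * (1 + \<delta> i y)"
                  using \<delta>_small[of i y] i that x r_pos[of y] ci by (intro mult_left_mono) auto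
                then show ?thesis
                  using cdf_eq[of i y] i x that by (simp add: mult_ac)
              qed
              show "exp (- ((1 + \<epsilon>) * c j) * r y) \<le> cdf (distr M borel (X j)) y" if "j \<in> J" "x \<le> y" for y j
              proof -
                have j: "1 \<le> j"
                  using that by (auto simp: J_def)
                have "c j * r y * (1 + \<delta> j y) \<le> c j * r y * (1 + \<epsilon>)"
                  using \<delta>_small[of j y] j that x r_pos[of y] c[of j] by (intro mult_left_mono) auto
                then show ?thesis
                  using cdf_eq[of j y] j x that by (simp add: mult_ac)
              qed
            qed (use J ci \<epsilon> c r_lim in \<open>auto simp: J_def\<close>)
            also have "{\<omega> \<in> space M. \<forall>j\<in>J. X j \<omega> \<le> X i \<omega>}
                = {\<omega> \<in> space M. X i \<omega> = Max ((\<lambda>j. X j \<omega>) ` {1..n})}"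
            proof (intro Collect_cong conj_cong refl)
              fix \<omega>
              show "(\<forall>j\<in>J. X j \<omega> \<le> X i \<omega>) \<longleftrightarrow> X i \<omega> = Max ((\<lambda>j. X j \<omega>) ` {1..n})"
                unfolding J(3)[symmetric] using J(1) by (subst eq_Max_iff) auto
            qed
            finally show ?thesis
              by (simp add: L_def p_def argmax_prob_def)
          qed
          have "exp (- L * r x) \<le> exp (ln (\<eta> / 2))"
          proof -
            have "(1 - \<epsilon>) * s n * r x \<le> L * r x"
              using L_ge r_pos[OF x] by (intro mult_right_mono) auto
            then show ?thesis
              using elim(1) by (simp add: mult_ac)
          qed
          then have exp_le: "1 - \<eta> / 2 \<le> 1 - exp (- L * r x)"
            using \<eta> by simp
          have "(1 - \<eta> / 2) * (1 + \<epsilon>) \<le> 1 - \<epsilon>"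
            using \<eta> by (simp add: \<epsilon>_def field_simps)
          then have "(1 - \<eta> / 2) * (1 + \<epsilon>) * s n \<le> (1 - \<epsilon>) * s n"
            using elim(2) by (intro mult_right_mono) auto
          moreover have "(1 - \<eta> / 2) * L \<le> (1 - \<eta> / 2) * ((1 + \<epsilon>) * s n)"
            using L_le \<eta> by (intro mult_left_mono) auto
          ultimately have "(1 - \<eta> / 2) * L \<le> (1 - \<epsilon>) * s n"
            by (simp add: mult_ac)
          then have "c i * ((1 - \<eta> / 2) * L) \<le> c i * ((1 - \<epsilon>) * s n)"
            using ci by (intro mult_left_mono) auto
          then have ratio: "(1 - \<eta> / 2) * q n i \<le> (1 - \<epsilon>) * c i / L"
            using elim(2) L_pos by (simp add: q_def divide_simps mult_ac)
          have q0: "0 \<le> q n i"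
            using ci elim(2) by (simp add: q_def)
          have "(1 - \<eta>) * q n i \<le> (1 - \<eta> / 2) * q n i * (1 - \<eta> / 2)"
          proof -
            have "1 - \<eta> \<le> (1 - \<eta> / 2) * (1 - \<eta> / 2)"
              by (simp add: algebra_simps)
            from mult_right_mono[OF this q0] show ?thesis
              by (simp add: mult_ac)
          qed
          also have "\<dots> \<le> (1 - \<epsilon>) * c i / L * (1 - exp (- L * r x))"
            using ratio exp_le q0 \<eta> L_pos ci \<epsilon> by (intro mult_mono) auto
          also note bound
          finally show ?thesis .
        qed
      qed
    qed
  qed
  have sum_p: "(\<Sum>i=1..n. p n i) \<le> 1" for n
    unfolding p_def using cdf_cont
    by (intro sum_argmax_prob_le_1 indep_vars_subset[OF indep]) auto
  \<comment> \<open>This holds at every \<open>x\<close>; continuity points of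
    \<open>\<alpha>\<close> enter only through the assumed convergence for the weights
    \<open>q\<close>.\<close>
  have diff: "(\<lambda>n. cdf (grid_measure n (p n)) x - cdf (grid_measure n (q n)) x) \<longlonglongrightarrow> 0" for x
  proof (rule tendstoI)
    fix e :: real assume e: "0 < e"
    \<comment> \<open>One bound makes \<open>\<eta>\<close> strictly smaller than \<open>e\<close>,
      the other keeps it below 1 as \<open>main\<close> requires.\<close>
    define \<eta> where "\<eta> = min (e / 2) (1 / 2)"
    have \<eta>: "0 < \<eta>" "\<eta> < 1" "\<eta> < e"
      using e by (auto simp: \<eta>_def)
    \<comment> \<open>For \<open>s n = 0\<close> division by zero would make all
      \<open>q n i\<close> zero, and their sum would not be 1.\<close>
    have "eventually (\<lambda>n. 0 < s n) sequentially"
      using c_sum by (simp add: filterlim_at_top_dense s_def)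
    with main[OF \<eta>(1,2)]
    show "eventually (\<lambda>n. dist (cdf (grid_measure n (p n)) x - cdf (grid_measure n (q n)) x) 0 < e) sequentially"
    proof eventually_elim
      case (elim n)
      have q: "0 \<le> q n i" if "i \<in> {1..n}" for i
        using that c[of i] elim(2) by (simp add: q_def)
      have "(\<Sum>i=1..n. q n i) = 1"
        using elim(2) by (simp add: q_def s_def sum_divide_distrib[symmetric])
      then have "\<bar>sum (p n) {i \<in> {1..n}. real i / real n \<le> x} - sum (q n) {i \<in> {1..n}. real i / real n \<le> x}\<bar> \<le> \<eta>"
        using q sum_p elim(1) \<eta> by (intro abs_diff_sum_subset_le[where I = "{1..n}"]) auto
      moreover have "cdf (grid_measure n (q n)) x = sum (q n) {i \<in> {1..n}. real i / real n \<le> x}"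
        using q by (rule cdf_grid_measure)
      moreover have "cdf (grid_measure n (p n)) x = sum (p n) {i \<in> {1..n}. real i / real n \<le> x}"
        using p_nonneg by (rule cdf_grid_measure)
      ultimately show ?case
        using \<eta> by simp
    qed
  qed
  show ?thesis
    unfolding weak_conv_m_def weak_conv_def
  proof safe
    fix x assume "isCont (cdf \<alpha>) x"
    then have "(\<lambda>n. cdf (grid_measure n (q n)) x) \<longlonglongrightarrow> cdf \<alpha> x"
      using conv by (simp add: weak_conv_m_def weak_conv_def q_def[abs_def] s_def)
    from tendsto_add[OF diff[of x] this]
    show "(\<lambda>n. cdf (grid_measure n (argmax_prob M X n)) x) \<longlonglongrightarrow> cdf \<alpha> x"
      by (simp add: p_def)
  qed
qed

end
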